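(* Let $\phi_0\in\mathrm{Mat}(m,m,\mathcal{B})$, $\boldsymbol{P},\boldsymbol{Q}\in\mathrm{Mat}(n,n,\mathcal{B})$, $\boldsymbol{U}\in\mathrm{Mat}(m,n,\mathcal{B})$, $\boldsymbol{V}\in\mathrm{Mat}(n,m,\mathcal{B})$, an invertible $\boldsymbol{X}\in\mathrm{Mat}(n,n,\mathcal{B})$, and $\boldsymbol{\alpha},\boldsymbol{\beta}\in\Omega^1$ (of size $n\times n$) satisfy $$\bar{\mathrm{d}}\boldsymbol{P}-(\mathrm{d}\boldsymbol{P})\,\boldsymbol{P}=-[\boldsymbol{\alpha},\boldsymbol{P}],\qquad \bar{\mathrm{d}}\boldsymbol{Q}-\boldsymbol{Q}\,\mathrm{d}\boldsymbol{Q}=[\boldsymbol{\beta},\boldsymbol{Q}],$$ $$\bar{\mathrm{d}}\boldsymbol{U}=(\mathrm{d}\boldsymbol{U})\,\boldsymbol{P}+(\mathrm{d}\phi_0)\,\boldsymbol{U}+\boldsymbol{U}\boldsymbol{\alpha},\qquad \bar{\mathrm{d}}\boldsymbol{V}=\boldsymbol{Q}\,\mathrm{d}\boldsymbol{V}-\boldsymbol{V}\,\mathrm{d}\phi_0+\boldsymbol{\beta}\boldsymbol{V},$$ $$\boldsymbol{X}\boldsymbol{P}-\boldsymbol{Q}\boldsymbol{X}=\boldsymbol{V}\boldsymbol{U},\qquad \bar{\mathrm{d}}\boldsymbol{X}-(\mathrm{d}\boldsymbol{X})\,\boldsymbol{P}+(\mathrm{d}\boldsymbol{Q})\,\boldsymbol{X}+(\mathrm{d}\boldsymbol{V})\,\boldsymbol{U}=\boldsymbol{X}\boldsymbol{\alpha}+\boldsymbol{\beta}\boldsymbol{X}.$$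 Set $\phi=\phi_0+\boldsymbol{U}\boldsymbol{X}^{-1}\boldsymbol{V}$. (1) If $\bar{\mathrm{d}}\phi_0-(\mathrm{d}\phi_0)\,\phi_0=0$ and $\boldsymbol{Q}\boldsymbol{V}=\boldsymbol{V}\phi_0$, then $\bar{\mathrm{d}}\phi-(\mathrm{d}\phi)\,\phi=0$. (2) If $\bar{\mathrm{d}}\phi_0+\phi_0\,\mathrm{d}\phi_0=0$ and $\boldsymbol{U}\boldsymbol{P}=-\phi_0\boldsymbol{U}$, then $\bar{\mathrm{d}}\phi+\phi\,\mathrm{d}\phi=0$.
   Context: $\mathcal{B}$ is a unital associative algebra, $\mathrm{Mat}(p,q,\mathcal{B})$ denotes the $p\times q$ matrices over $\mathcal{B}$, and $\mathcal{A}$ is the algebra of all finite-dimensional matrices with entries in $\mathcal{B}$, where the product of two matrices is defined to be zero if their sizes do not match. $\Omega^1$ is an $\mathcal{A}$-bimodule and $\mathrm{d},\bar{\mathrm{d}}:\mathcal{A}\to\Omega^1$ are derivations (linear maps with $\mathrm{d}(ab)=(\mathrm{d}a)b+a\,\mathrm{d}b$, and likewise for $\bar{\mathrm{d}}$) that preserve the size of matrices; an element $\omega\in\Omega^1$ has size $p\times q$ if $I_p\,\omega\,I_q=\omega$. No second-order extension of $\mathrm{d},\bar{\mathrm{d}}$ is assumed. The identity matrices $I_m$ and $I_n$ are annihilated by $\mathrm{d}$ and $\bar{\mathrm{d}}$. $[\boldsymbol{\alpha},\boldsymbol{P}]=\boldsymbol{\alpha}\boldsymbol{P}-\boldsymbol{P}\boldsymbol{\alpha}$;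 $m,n\in\mathbb{N}$ are fixed. *)

theory Defs
  imports "Jordan_Normal_Form.Matrix"
begin

text \<open>
  The algebra of all finite-dimensional matrices over \<open>'b\<close>, i.e. the direct sum of
  the \<open>p \<times> q\<close> matrices over all sizes \<open>(p, q)\<close>. The value of an element at
  \<open>(p, i)\<close>, \<open>(q, j)\<close> is the \<open>(i, j)\<close> entry of its \<open>p \<times> q\<close> component. The product below
  therefore multiplies components of matching sizes as matrices, and gives zero on components
  whose sizes do not match (see \<open>of_mat_mult\<close> and \<open>of_mat_mult_mismatch\<close>).
\<close>

typedef (overloaded) 'b matalg =
  "{f :: nat \<times> nat \<Rightarrow> nat \<times> nat \<Rightarrow> 'b::zero.
      finite {(x, y). f x y \<noteq> 0} \<and>
      (\<forall>p i q j. f (p, i) (q, j) \<noteq> 0 \<longrightarrow> i < p \<and> j < q)}"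
  morphisms entry Abs_matalg
  by (rule exI[of _ "\<lambda>x y. 0"]) simp

setup_lifting type_definition_matalg

lemma entry_finite: "finite {(x, y). entry a x y \<noteq> 0}"
  using entry[of a] by simp

lemma entry_row_finite: "finite {y. entry a x y \<noteq> 0}"
proof (rule finite_subset[OF _ finite_imageI[OF entry_finite[of a], of snd]])
  show "{y. entry a x y \<noteq> 0} \<subseteq> snd ` {(x, y). entry a x y \<noteq> 0}"
  proof
    fix y assume "y \<in> {y. entry a x y \<noteq> 0}"
    then show "y \<in> snd ` {(x, y). entry a x y \<noteq> 0}"
      by (intro rev_image_eqI[of "(x, y)"]) simp_all
  qed
qed

lemma matalg_eqI: "(\<And>x y. entry a x y = entry b x y) \<Longrightarrow> a = b"
  by (simp add: entry_inject[symmetric] fun_eq_iff)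

instantiation matalg :: (ring) ring
begin

lift_definition zero_matalg :: "'a matalg" is "\<lambda>x y. 0"
  by simp

lift_definition plus_matalg :: "'a matalg \<Rightarrow> 'a matalg \<Rightarrow> 'a matalg"
  is "\<lambda>f g x y. f x y + g x y"
proof (intro conjI)
  fix f g :: "nat \<times> nat \<Rightarrow> nat \<times> nat \<Rightarrow> 'a"
  assume f: "finite {(x, y). f x y \<noteq> 0} \<and> (\<forall>p i q j. f (p, i) (q, j) \<noteq> 0 \<longrightarrow> i < p \<and> j < q)"
    and g: "finite {(x, y). g x y \<noteq> 0} \<and> (\<forall>p i q j. g (p, i) (q, j) \<noteq> 0 \<longrightarrow> i < p \<and> j < q)"
  show "finite {(x, y). f x y + g x y \<noteq> 0}"
    by (rule finite_subset[of _ "{(x, y). f x y \<noteq> 0} \<union> {(x, y). g x y \<noteq> 0}"]) (use f g in auto)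
  show "\<forall>p i q j. f (p, i) (q, j) + g (p, i) (q, j) \<noteq> 0 \<longrightarrow> i < p \<and> j < q"
    using f g by (metis add.right_neutral)
qed

lift_definition uminus_matalg :: "'a matalg \<Rightarrow> 'a matalg" is "\<lambda>f x y. - f x y"
  by simp

lift_definition minus_matalg :: "'a matalg \<Rightarrow> 'a matalg \<Rightarrow> 'a matalg"
  is "\<lambda>f g x y. f x y - g x y"
proof (intro conjI)
  fix f g :: "nat \<times> nat \<Rightarrow> nat \<times> nat \<Rightarrow> 'a"
  assume f: "finite {(x, y). f x y \<noteq> 0} \<and> (\<forall>p i q j. f (p, i) (q, j) \<noteq> 0 \<longrightarrow> i < p \<and> j < q)"
    and g: "finite {(x, y). g x y \<noteq> 0} \<and> (\<forall>p i q j. g (p, i) (q, j) \<noteq> 0 \<longrightarrow> i < p \<and> j < q)"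
  show "finite {(x, y). f x y - g x y \<noteq> 0}"
    by (rule finite_subset[of _ "{(x, y). f x y \<noteq> 0} \<union> {(x, y). g x y \<noteq> 0}"]) (use f g in auto)
  show "\<forall>p i q j. f (p, i) (q, j) - g (p, i) (q, j) \<noteq> 0 \<longrightarrow> i < p \<and> j < q"
    using f g by (metis diff_zero)
qed

lift_definition times_matalg :: "'a matalg \<Rightarrow> 'a matalg \<Rightarrow> 'a matalg"
  is "\<lambda>f g x z. \<Sum>y | f x y \<noteq> 0. f x y * g y z"
proof (intro conjI)
  fix f g :: "nat \<times> nat \<Rightarrow> nat \<times> nat \<Rightarrow> 'a"
  assume f: "finite {(x, y). f x y \<noteq> 0} \<and> (\<forall>p i q j. f (p, i) (q, j) \<noteq> 0 \<longrightarrow> i < p \<and> j < q)"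
    and g: "finite {(x, y). g x y \<noteq> 0} \<and> (\<forall>p i q j. g (p, i) (q, j) \<noteq> 0 \<longrightarrow> i < p \<and> j < q)"
  have *: "\<exists>y. f x y \<noteq> 0 \<and> g y z \<noteq> 0" if "(\<Sum>y | f x y \<noteq> 0. f x y * g y z) \<noteq> 0" for x z
  proof -
    from that obtain y where "f x y * g y z \<noteq> 0"
      by (rule sum.not_neutral_contains_not_neutral)
    then show ?thesis by (intro exI[of _ y]) auto
  qed
  have "{(x, z). (\<Sum>y | f x y \<noteq> 0. f x y * g y z) \<noteq> 0}
      \<subseteq> fst ` {(x, y). f x y \<noteq> 0} \<times> snd ` {(x, y). g x y \<noteq> 0}"
  proof (rule subrelI)
    fix x z
    assume "(x, z) \<in> {(x, z). (\<Sum>y | f x y \<noteq> 0. f x y * g y z) \<noteq> 0}"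
    then have "(\<Sum>y | f x y \<noteq> 0. f x y * g y z) \<noteq> 0" by simp
    from *[OF this] obtain y where "f x y \<noteq> 0" "g y z \<noteq> 0" by blast
    then show "(x, z) \<in> fst ` {(x, y). f x y \<noteq> 0} \<times> snd ` {(x, y). g x y \<noteq> 0}"
      by (intro SigmaI rev_image_eqI[of "(x, y)"] rev_image_eqI[of "(y, z)"]) simp_all
  qed
  then show "finite {(x, z). (\<Sum>y | f x y \<noteq> 0. f x y * g y z) \<noteq> 0}"
    by (rule finite_subset) (use f g in simp)
  show "\<forall>p i q j. (\<Sum>y | f (p, i) y \<noteq> 0. f (p, i) y * g y (q, j)) \<noteq> 0 \<longrightarrow> i < p \<and> j < q"
  proof (intro allI impI)
    fix p i q j
    assume "(\<Sum>y | f (p, i) y \<noteq> 0. f (p, i) y * g y (q, j)) \<noteq> 0"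
    from *[OF this] obtain r k where "f (p, i) (r, k) \<noteq> 0" "g (r, k) (q, j) \<noteq> 0"
      by (metis surj_pair)
    then show "i < p \<and> j < q" using f g by blast
  qed
qed

lemma entry_times_superset:
  assumes "finite Y" "{y. entry a x y \<noteq> 0} \<subseteq> Y"
  shows "entry (a * b) x z = (\<Sum>y\<in>Y. entry a x y * entry b y z)"
  unfolding times_matalg.rep_eq using assms
  by (intro sum.mono_neutral_left) auto

instance
proof
  fix a b c :: "'a matalg"
  show "a + b + c = a + (b + c)" by transfer (simp add: add.assoc)
  show "a + b = b + a" by transfer (simp add: add.commute)
  show "0 + a = a" by transfer simp
  show "- a + a = 0" by transfer simp
  show "a - b = a + - b" by transfer simp
  show "a * b * c = a * (b * c)"
  proof (rule matalg_eqI)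
    fix x w
    let ?Y = "{y. entry a x y \<noteq> 0}"
    let ?Z = "snd ` {(y, z). entry b y z \<noteq> 0}"
    have Y: "finite ?Y" by (rule entry_row_finite)
    have Z: "finite ?Z" by (intro finite_imageI entry_finite)
    have sub: "{z. entry b y z \<noteq> 0} \<subseteq> ?Z" for y
    proof
      fix z assume "z \<in> {z. entry b y z \<noteq> 0}"
      then show "z \<in> ?Z" by (intro rev_image_eqI[of "(y, z)"]) simp_all
    qed
    have "{z. entry (a * b) x z \<noteq> 0} \<subseteq> ?Z"
    proof
      fix z assume "z \<in> {z. entry (a * b) x z \<noteq> 0}"
      then obtain y where "entry a x y * entry b y z \<noteq> 0"
        unfolding times_matalg.rep_eq mem_Collect_eq
        by (rule sum.not_neutral_contains_not_neutral)
      then have "entry b y z \<noteq> 0" by auto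
      with sub[of y] show "z \<in> ?Z" by blast
    qed
    from Z this have "entry (a * b * c) x w = (\<Sum>z\<in>?Z. entry (a * b) x z * entry c z w)"
      by (rule entry_times_superset)
    also have "\<dots> = (\<Sum>z\<in>?Z. \<Sum>y\<in>?Y. entry a x y * entry b y z * entry c z w)"
      by (intro sum.cong refl) (simp only: times_matalg.rep_eq sum_distrib_right)
    also have "\<dots> = (\<Sum>y\<in>?Y. \<Sum>z\<in>?Z. entry a x y * entry b y z * entry c z w)"
      by (rule sum.swap)
    also have "\<dots> = entry (a * (b * c)) x w"
      unfolding entry_times_superset[OF Y order_refl] entry_times_superset[OF Z sub]
      by (simp add: sum_distrib_left mult.assoc)
    finally show "entry (a * b * c) x w = entry (a * (b * c)) x w" .
  qed
  show "(a + b) * c = a * c + b * c"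
  proof (rule matalg_eqI)
    fix x z
    let ?Y = "{y. entry a x y \<noteq> 0} \<union> {y. entry b x y \<noteq> 0}"
    have Y: "finite ?Y" by (simp add: entry_row_finite)
    have s: "{y. entry (a + b) x y \<noteq> 0} \<subseteq> ?Y" by (auto simp: plus_matalg.rep_eq)
    show "entry ((a + b) * c) x z = entry (a * c + b * c) x z"
      by (simp add: entry_times_superset[OF Y s] entry_times_superset[OF Y Un_upper1]
          entry_times_superset[OF Y Un_upper2] plus_matalg.rep_eq distrib_right sum.distrib)
  qed
  show "a * (b + c) = a * b + a * c"
    by (rule matalg_eqI) (simp add: times_matalg.rep_eq plus_matalg.rep_eq distrib_left sum.distrib)
qed

end

lift_definition of_mat :: "'b::zero mat \<Rightarrow> 'b matalg"
  is "\<lambda>M (p, i) (q, j).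
        if p = dim_row M \<and> q = dim_col M \<and> i < p \<and> j < q then M $$ (i, j) else 0"
proof (intro conjI)
  fix M :: "'b mat"
  let ?f = "\<lambda>(p, i) (q, j).
        if p = dim_row M \<and> q = dim_col M \<and> i < p \<and> j < q then M $$ (i, j) else 0"
  show "finite {(x, y). ?f x y \<noteq> 0}"
    by (rule finite_subset[of _ "({dim_row M} \<times> {..<dim_row M}) \<times> ({dim_col M} \<times> {..<dim_col M})"])
      (auto split: if_splits)
  show "\<forall>p i q j. ?f (p, i) (q, j) \<noteq> 0 \<longrightarrow> i < p \<and> j < q"
    by auto
qed

definition Mat :: "nat \<Rightarrow> nat \<Rightarrow> 'b::zero matalg set" where
  "Mat p q = of_mat ` carrier_mat p q"

definition Idm :: "nat \<Rightarrow> 'b::ring_1 matalg" where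
  "Idm p = of_mat (1\<^sub>m p)"

lemma of_mat_add:
  assumes "M \<in> carrier_mat p q" "N \<in> carrier_mat p q"
  shows "of_mat (M + N) = of_mat M + of_mat (N :: 'b::ring mat)"
  by (rule matalg_eqI) (use assms in \<open>auto simp: of_mat.rep_eq plus_matalg.rep_eq\<close>)

lemma of_mat_mult:
  assumes M: "M \<in> carrier_mat p q" and N: "N \<in> carrier_mat q r"
  shows "of_mat (M * N) = of_mat M * of_mat (N :: 'b::ring mat)"
proof (rule matalg_eqI)
  fix x z :: "nat \<times> nat"
  obtain p' i r' k where xz: "x = (p', i)" "z = (r', k)" by fastforce
  let ?Y = "Pair q ` {..<q}"
  have sub: "{y. entry (of_mat M) x y \<noteq> 0} \<subseteq> ?Y"
    using M by (auto simp: xz of_mat.rep_eq split: if_splits)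
  have "entry (of_mat M * of_mat N) x z = (\<Sum>y\<in>?Y. entry (of_mat M) x y * entry (of_mat N) y z)"
    by (rule entry_times_superset[OF _ sub]) simp
  also have "\<dots> = (\<Sum>j<q. entry (of_mat M) x (q, j) * entry (of_mat N) (q, j) z)"
    by (subst sum.reindex) (auto intro: inj_onI)
  also have "\<dots> = entry (of_mat (M * N)) x z"
  proof (cases "p' = p \<and> i < p \<and> r' = r \<and> k < r")
    case True
    then have "entry (of_mat (M * N)) x z = (\<Sum>j<q. M $$ (i, j) * N $$ (j, k))"
      using M N by (simp add: xz of_mat.rep_eq scalar_prod_def lessThan_atLeast0)
    moreover have "(\<Sum>j<q. entry (of_mat M) x (q, j) * entry (of_mat N) (q, j) z)
        = (\<Sum>j<q. M $$ (i, j) * N $$ (j, k))"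
      by (rule sum.cong) (use M N True in \<open>simp_all add: xz of_mat.rep_eq\<close>)
    ultimately show ?thesis by simp
  next
    case False
    then have "entry (of_mat (M * N)) x z = 0"
      using M N by (auto simp: xz of_mat.rep_eq)
    moreover have "(\<Sum>j<q. entry (of_mat M) x (q, j) * entry (of_mat N) (q, j) z) = 0"
      by (rule sum.neutral) (use M N False in \<open>auto simp: xz of_mat.rep_eq\<close>)
    ultimately show ?thesis by simp
  qed
  finally show "entry (of_mat (M * N)) x z = entry (of_mat M * of_mat N) x z" ..
qed

lemma of_mat_mult_mismatch:
  assumes "dim_col M \<noteq> dim_row N"
  shows "of_mat M * of_mat (N :: 'b::ring mat) = 0"
  by (rule matalg_eqI)
    (use assms in \<open>auto simp: times_matalg.rep_eq of_mat.rep_eq zero_matalg.rep_eq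
        intro!: sum.neutral split: if_splits\<close>)

lemma of_mat_inject:
  assumes "M \<in> carrier_mat p q" "N \<in> carrier_mat p q" "of_mat M = of_mat N"
  shows "M = N"
proof (rule eq_matI)
  fix i j assume "i < dim_row N" "j < dim_col N"
  then show "M $$ (i, j) = N $$ (i, j)"
    using assms(1,2) arg_cong[OF assms(3), of "\<lambda>a. entry a (p, i) (q, j)"]
    by (auto simp: of_mat.rep_eq)
qed (use assms in auto)

lemma Idm_mult:
  assumes "a \<in> Mat p q"
  shows "Idm p * a = a" "a * Idm q = a"
proof -
  obtain M where M: "M \<in> carrier_mat p q" and a: "a = of_mat M"
    using assms by (auto simp: Mat_def)
  show "Idm p * a = a"
    unfolding a Idm_def of_mat_mult[OF one_carrier_mat M, symmetric] by (simp only: left_mult_one_mat[OF M])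
  show "a * Idm q = a"
    unfolding a Idm_def of_mat_mult[OF M one_carrier_mat, symmetric] by (simp only: right_mult_one_mat[OF M])
qed

text \<open>
  Algebras and bimodules are not required to be unital, since the algebra of all matrices has no
  unit. The prefix \<open>Modules\<close> refers to modules over a type of class \<open>comm_ring_1\<close>.
\<close>

locale assoc_algebra = Modules.module scale
  for scale :: "'k::comm_ring_1 \<Rightarrow> 'a::ring \<Rightarrow> 'a" +
  assumes scale_mult_left: "scale c (a * b) = scale c a * b"
    and scale_mult_right: "scale c (a * b) = a * scale c b"

locale algebra_bimodule =
  A: assoc_algebra scaleA + W: Modules.module scaleW
  for scaleA :: "'k::comm_ring_1 \<Rightarrow> 'a::ring \<Rightarrow> 'a"
    and scaleW :: "'k \<Rightarrow> 'w::ab_group_add \<Rightarrow> 'w" +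
  fixes lact :: "'a \<Rightarrow> 'w \<Rightarrow> 'w" (infixr "\<cdot>\<^sub>l" 70)
    and ract :: "'w \<Rightarrow> 'a \<Rightarrow> 'w" (infixl "\<cdot>\<^sub>r" 70)
  assumes lact_add_left: "(a + b) \<cdot>\<^sub>l w = a \<cdot>\<^sub>l w + b \<cdot>\<^sub>l w"
    and lact_add_right: "a \<cdot>\<^sub>l (v + w) = a \<cdot>\<^sub>l v + a \<cdot>\<^sub>l w"
    and lact_scale_left: "scaleA c a \<cdot>\<^sub>l w = scaleW c (a \<cdot>\<^sub>l w)"
    and lact_scale_right: "a \<cdot>\<^sub>l scaleW c w = scaleW c (a \<cdot>\<^sub>l w)"
    and ract_add_left: "(v + w) \<cdot>\<^sub>r a = v \<cdot>\<^sub>r a + w \<cdot>\<^sub>r a"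
    and ract_add_right: "w \<cdot>\<^sub>r (a + b) = w \<cdot>\<^sub>r a + w \<cdot>\<^sub>r b"
    and ract_scale_left: "scaleW c w \<cdot>\<^sub>r a = scaleW c (w \<cdot>\<^sub>r a)"
    and ract_scale_right: "w \<cdot>\<^sub>r scaleA c a = scaleW c (w \<cdot>\<^sub>r a)"
    and lact_mult: "(a * b) \<cdot>\<^sub>l w = a \<cdot>\<^sub>l (b \<cdot>\<^sub>l w)"
    and ract_mult: "w \<cdot>\<^sub>r (a * b) = (w \<cdot>\<^sub>r a) \<cdot>\<^sub>r b"
    and lact_ract: "(a \<cdot>\<^sub>l w) \<cdot>\<^sub>r b = a \<cdot>\<^sub>l (w \<cdot>\<^sub>r b)"

locale derivation =
  algebra_bimodule scaleA scaleW lact ract + Modules.module_hom scaleA scaleW D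
  for scaleA :: "'k::comm_ring_1 \<Rightarrow> 'a::ring \<Rightarrow> 'a"
    and scaleW :: "'k \<Rightarrow> 'w::ab_group_add \<Rightarrow> 'w"
    and lact :: "'a \<Rightarrow> 'w \<Rightarrow> 'w" (infixr "\<cdot>\<^sub>l" 70)
    and ract :: "'w \<Rightarrow> 'a \<Rightarrow> 'w" (infixl "\<cdot>\<^sub>r" 70)
    and D :: "'a \<Rightarrow> 'w" +
  assumes leibniz: "D (a * b) = D a \<cdot>\<^sub>r b + a \<cdot>\<^sub>l D b"

text \<open>
  The entrywise scalar multiplication; it is only meaningful when \<open>s c 0 = 0\<close>, which holds for
  every algebra structure \<open>s\<close> on \<open>'b\<close>.
\<close>

definition mat_scale :: "('k \<Rightarrow> 'b::zero \<Rightarrow> 'b) \<Rightarrow> 'k \<Rightarrow> 'b matalg \<Rightarrow> 'b matalg" where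
  "mat_scale s c a = Abs_matalg (\<lambda>x y. s c (entry a x y))"

lemma entry_mat_scale:
  assumes "s c 0 = 0"
  shows "entry (mat_scale s c a) x y = s c (entry a x y)"
proof -
  have "finite {(x, y). s c (entry a x y) \<noteq> 0}"
    by (rule finite_subset[OF _ entry_finite[of a]]) (use assms in auto)
  moreover have "\<forall>p i q j. s c (entry a (p, i) (q, j)) \<noteq> 0 \<longrightarrow> i < p \<and> j < q"
    using entry[of a] assms by (simp, metis)
  ultimately show ?thesis
    unfolding mat_scale_def by (subst Abs_matalg_inverse) auto
qed

lemma assoc_algebra_mat_scale:
  assumes "assoc_algebra s"
  shows "assoc_algebra (mat_scale s)"
proof -
  interpret assoc_algebra s by fact
  note [simp] = entry_mat_scale[of s, OF scale_zero_right]
  show ?thesis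
  proof
    fix a b :: "'b matalg" and c e
    show "mat_scale s c (a + b) = mat_scale s c a + mat_scale s c b"
      by (rule matalg_eqI) (simp add: plus_matalg.rep_eq scale_right_distrib)
    show "mat_scale s (c + e) a = mat_scale s c a + mat_scale s e a"
      by (rule matalg_eqI) (simp add: plus_matalg.rep_eq scale_left_distrib)
    show "mat_scale s c (mat_scale s e a) = mat_scale s (c * e) a"
      by (rule matalg_eqI) simp
    show "mat_scale s 1 a = a"
      by (rule matalg_eqI) simp
    show "mat_scale s c (a * b) = a * mat_scale s c b"
      by (rule matalg_eqI) (simp add: times_matalg.rep_eq scale_sum_right scale_mult_right)
    show "mat_scale s c (a * b) = mat_scale s c a * b"
    proof (rule matalg_eqI)
      fix x z
      have sub: "{y. entry (mat_scale s c a) x y \<noteq> 0} \<subseteq> {y. entry a x y \<noteq> 0}" by auto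
      show "entry (mat_scale s c (a * b)) x z = entry (mat_scale s c a * b) x z"
        unfolding entry_times_superset[OF entry_row_finite sub]
        by (simp add: times_matalg.rep_eq scale_sum_right scale_mult_left)
    qed
  qed
qed

definition has_size ::
  "('b::ring_1 matalg \<Rightarrow> 'w \<Rightarrow> 'w) \<Rightarrow> ('w \<Rightarrow> 'b matalg \<Rightarrow> 'w) \<Rightarrow> nat \<Rightarrow> nat \<Rightarrow> 'w \<Rightarrow> bool" where
  "has_size lact ract p q w \<longleftrightarrow> ract (lact (Idm p) w) (Idm q) = w"

definition preserves_size ::
  "('b::ring_1 matalg \<Rightarrow> 'w \<Rightarrow> 'w) \<Rightarrow> ('w \<Rightarrow> 'b matalg \<Rightarrow> 'w) \<Rightarrow> ('b matalg \<Rightarrow> 'w) \<Rightarrow> bool" where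
  "preserves_size lact ract D \<longleftrightarrow> (\<forall>p q. \<forall>a \<in> Mat p q. has_size lact ract p q (D a))"

end

theory Submission
  imports Defs
begin

text \<open>
  With \<open>Z = X\<^sup>-\<^sup>1 V\<close> and \<open>W = U X\<^sup>-\<^sup>1\<close> we have \<open>\<phi> = \<phi>\<^sub>0 + U Z = \<phi>\<^sub>0 + W V\<close>, and for every derivation
  \<open>D (U Z) = D U Z + W D V - W D X Z\<close>, which avoids the inverse altogether. Inserting the equations
  for \<open>dbar U\<close>, \<open>dbar V\<close>, \<open>dbar X\<close> cancels \<open>\<alpha>\<close> and \<open>\<beta>\<close>. In (1) the equation \<open>X P - Q X = V U\<close> turns
  into \<open>P Z = Z \<phi>\<close>, in (2) into \<open>W Q = - \<phi> W\<close>; these collect the remaining terms into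
  \<open>d \<phi> \<phi>\<close> and \<open>- \<phi> d \<phi>\<close>, respectively.
\<close>

context algebra_bimodule
begin

lemma lact_minus_right: "a \<cdot>\<^sub>l (- w) = - (a \<cdot>\<^sub>l w)"
  using lact_add_right[of a w "- w"] lact_add_right[of a 0 0] by (simp add: eq_neg_iff_add_eq_0 add.commute)

lemma lact_minus_left: "(- a) \<cdot>\<^sub>l w = - (a \<cdot>\<^sub>l w)"
  using lact_add_left[of a "- a" w] lact_add_left[of 0 0 w] by (simp add: eq_neg_iff_add_eq_0 add.commute)

lemma ract_minus_left: "(- w) \<cdot>\<^sub>r a = - (w \<cdot>\<^sub>r a)"
  using ract_add_left[of w "- w" a] ract_add_left[of 0 0 a] by (simp add: eq_neg_iff_add_eq_0 add.commute)

lemma lact_diff_right: "a \<cdot>\<^sub>l (v - w) = a \<cdot>\<^sub>l v - a \<cdot>\<^sub>l w"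
  using lact_add_right[of a v "- w"] by (simp add: lact_minus_right)

lemma ract_diff_left: "(v - w) \<cdot>\<^sub>r a = v \<cdot>\<^sub>r a - w \<cdot>\<^sub>r a"
  using ract_add_left[of v "- w" a] by (simp add: ract_minus_left)

text \<open>Together with \<open>act_assocs\<close> these expand an expression into a signed sum of
  nested actions, right actions innermost, so that \<open>simp\<close> can cancel equal
  terms.\<close>

lemmas act_distribs =
  lact_add_left lact_add_right lact_minus_left lact_minus_right lact_diff_right
  ract_add_left ract_add_right ract_minus_left ract_diff_left

lemmas act_assocs = lact_mult ract_mult lact_ract

end

text \<open>Applying \<open>W\<close> from the left to the Leibniz rule for \<open>X * Z = V\<close>
  produces \<open>W * X = U\<close> in front of \<open>D Z\<close>. This expresses the term with
  \<open>D Z\<close> in \<open>D (U * Z)\<close> through \<open>D V\<close> and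
  \<open>D X\<close>.\<close>

lemma (in derivation) derivation_sandwich:
  assumes "X * Z = V" and "W * X = U"
  shows "D (U * Z) = D U \<cdot>\<^sub>r Z + W \<cdot>\<^sub>l D V - W \<cdot>\<^sub>l (D X \<cdot>\<^sub>r Z)"
proof -
  have "W \<cdot>\<^sub>l D V = W \<cdot>\<^sub>l (D X \<cdot>\<^sub>r Z) + U \<cdot>\<^sub>l D Z"
    unfolding assms(1)[symmetric] assms(2)[symmetric]
    by (simp add: leibniz act_distribs act_assocs)
  then show ?thesis by (simp add: leibniz)
qed

text \<open>Matrices are left behind here: the inverse of \<open>X\<close> enters only through
  \<open>Z\<close> and \<open>W\<close>, so the computation makes sense in an algebra without
  unit.\<close>

locale derivation_pair =
  d: derivation scaleA scaleW lact ract d + dbar: derivation scaleA scaleW lact ract dbar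
  for scaleA :: "'k::comm_ring_1 \<Rightarrow> 'a::ring \<Rightarrow> 'a"
    and scaleW :: "'k \<Rightarrow> 'w::ab_group_add \<Rightarrow> 'w"
    and lact :: "'a \<Rightarrow> 'w \<Rightarrow> 'w" (infixr "\<cdot>\<^sub>l" 70)
    and ract :: "'w \<Rightarrow> 'a \<Rightarrow> 'w" (infixl "\<cdot>\<^sub>r" 70)
    and d dbar :: "'a \<Rightarrow> 'w"
begin

text \<open>In the sandwich formula \<alpha> cancels by \<open>W * X = U\<close> and \<beta> by
  \<open>X * Z = V\<close>. The latter also turns \<open>d Q\<close> acting on \<open>X * Z\<close>
  into the missing half of \<open>d (Q * V)\<close>.\<close>

lemma dbar_dressing:
  assumes XZ: "X * Z = V" and WX: "W * X = U"
    and dbarU: "dbar U = d U \<cdot>\<^sub>r P + d \<phi>\<^sub>0 \<cdot>\<^sub>r U + U \<cdot>\<^sub>l \<alpha>"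
    and dbarV: "dbar V = Q \<cdot>\<^sub>l d V - V \<cdot>\<^sub>l d \<phi>\<^sub>0 + \<beta> \<cdot>\<^sub>r V"
    and dbarX: "dbar X - d X \<cdot>\<^sub>r P + d Q \<cdot>\<^sub>r X + d V \<cdot>\<^sub>r U = X \<cdot>\<^sub>l \<alpha> + \<beta> \<cdot>\<^sub>r X"
  shows "dbar (U * Z) = (d U - W \<cdot>\<^sub>l d X) \<cdot>\<^sub>r (P * Z) + d \<phi>\<^sub>0 \<cdot>\<^sub>r (U * Z)
    + W \<cdot>\<^sub>l d (Q * V) - (W * V) \<cdot>\<^sub>l d \<phi>\<^sub>0 + W \<cdot>\<^sub>l (d V \<cdot>\<^sub>r (U * Z))"
proof -
  have dbarX': "dbar X = d X \<cdot>\<^sub>r P - d Q \<cdot>\<^sub>r X - d V \<cdot>\<^sub>r U + X \<cdot>\<^sub>l \<alpha> + \<beta> \<cdot>\<^sub>r X"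
    using dbarX by (simp add: algebra_simps)
  \<comment> \<open>Normalization splits products into successive actions, so \<open>XZ\<close> and
    \<open>WX\<close> are restated in that form.\<close>
  have V: "w \<cdot>\<^sub>r X \<cdot>\<^sub>r Z = w \<cdot>\<^sub>r V" for w
    by (simp add: XZ flip: d.ract_mult)
  have U: "W \<cdot>\<^sub>l X \<cdot>\<^sub>l w = U \<cdot>\<^sub>l w" for w
    by (simp add: WX flip: d.lact_mult)
  show ?thesis
    unfolding dbar.derivation_sandwich[OF XZ WX] dbarU dbarV dbarX'
    by (simp add: d.leibniz d.act_distribs d.act_assocs V U)
qed

text \<open>By \<open>QV\<close>, \<open>d (Q * V)\<close> has two terms: the one with
  \<open>d \<phi>\<^sub>0\<close> cancels, the other completes \<open>U * Z\<close> to \<phi> behind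
  \<open>d V\<close>. By \<open>PZ\<close>, \<phi> also appears behind \<open>d U\<close> and
  \<open>d X\<close>.\<close>

lemma dressing_right:
  assumes XZ: "X * Z = V" and WX: "W * X = U"
    and dbarU: "dbar U = d U \<cdot>\<^sub>r P + d \<phi>\<^sub>0 \<cdot>\<^sub>r U + U \<cdot>\<^sub>l \<alpha>"
    and dbarV: "dbar V = Q \<cdot>\<^sub>l d V - V \<cdot>\<^sub>l d \<phi>\<^sub>0 + \<beta> \<cdot>\<^sub>r V"
    and dbarX: "dbar X - d X \<cdot>\<^sub>r P + d Q \<cdot>\<^sub>r X + d V \<cdot>\<^sub>r U = X \<cdot>\<^sub>l \<alpha> + \<beta> \<cdot>\<^sub>r X"
    and \<phi>: "\<phi> = \<phi>\<^sub>0 + U * Z"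
    and PZ: "P * Z = Z * \<phi>"
    and QV: "Q * V = V * \<phi>\<^sub>0"
    and seed: "dbar \<phi>\<^sub>0 = d \<phi>\<^sub>0 \<cdot>\<^sub>r \<phi>\<^sub>0"
  shows "dbar \<phi> = d \<phi> \<cdot>\<^sub>r \<phi>"
proof -
  have d\<phi>: "d \<phi> = d \<phi>\<^sub>0 + (d U \<cdot>\<^sub>r Z + W \<cdot>\<^sub>l d V - W \<cdot>\<^sub>l (d X \<cdot>\<^sub>r Z))"
    by (simp add: \<phi> d.add d.derivation_sandwich[OF XZ WX])
  have "dbar \<phi> = d \<phi>\<^sub>0 \<cdot>\<^sub>r \<phi>\<^sub>0 + ((d U - W \<cdot>\<^sub>l d X) \<cdot>\<^sub>r (Z * \<phi>) + d \<phi>\<^sub>0 \<cdot>\<^sub>r (U * Z)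
      + W \<cdot>\<^sub>l d (V * \<phi>\<^sub>0) - (W * V) \<cdot>\<^sub>l d \<phi>\<^sub>0 + W \<cdot>\<^sub>l (d V \<cdot>\<^sub>r (U * Z)))"
    by (simp add: \<phi> dbar.add seed dbar_dressing[OF XZ WX dbarU dbarV dbarX] QV PZ[unfolded \<phi>])
  also have "\<dots> = d \<phi>\<^sub>0 \<cdot>\<^sub>r \<phi> + (d U \<cdot>\<^sub>r Z - W \<cdot>\<^sub>l (d X \<cdot>\<^sub>r Z)) \<cdot>\<^sub>r \<phi> + W \<cdot>\<^sub>l (d V \<cdot>\<^sub>r \<phi>)"
    by (simp add: \<phi> d.leibniz d.act_distribs d.act_assocs)
  also have "\<dots> = d \<phi> \<cdot>\<^sub>r \<phi>"
    by (simp add: d\<phi> d.act_distribs d.act_assocs)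
  finally show ?thesis .
qed

text \<open>Now \<phi> has to be collected on the left, while \<open>P\<close> and
  \<open>d Q\<close> stand on the right or in the middle. Differentiating the two algebraic
  equations \<open>sylv\<close> and \<open>UP\<close> eliminates them.\<close>

lemma dressing_left:
  assumes XZ: "X * Z = V" and WX: "W * X = U"
    and dbarU: "dbar U = d U \<cdot>\<^sub>r P + d \<phi>\<^sub>0 \<cdot>\<^sub>r U + U \<cdot>\<^sub>l \<alpha>"
    and dbarV: "dbar V = Q \<cdot>\<^sub>l d V - V \<cdot>\<^sub>l d \<phi>\<^sub>0 + \<beta> \<cdot>\<^sub>r V"
    and sylv: "X * P - Q * X = V * U"
    and dbarX: "dbar X - d X \<cdot>\<^sub>r P + d Q \<cdot>\<^sub>r X + d V \<cdot>\<^sub>r U = X \<cdot>\<^sub>l \<alpha> + \<beta> \<cdot>\<^sub>r X"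
    and \<phi>: "\<phi> = \<phi>\<^sub>0 + U * Z"
    and WQ: "W * Q = - (\<phi> * W)"
    and UP: "U * P = - (\<phi>\<^sub>0 * U)"
    and seed: "dbar \<phi>\<^sub>0 = - (\<phi>\<^sub>0 \<cdot>\<^sub>l d \<phi>\<^sub>0)"
  shows "dbar \<phi> = - (\<phi> \<cdot>\<^sub>l d \<phi>)"
proof -
  have WV: "W * V = U * Z" by (simp add: XZ[symmetric] WX[symmetric] mult.assoc)
  have V: "w \<cdot>\<^sub>r X \<cdot>\<^sub>r Z = w \<cdot>\<^sub>r V" for w
    by (simp add: XZ flip: d.ract_mult)
  have U: "W \<cdot>\<^sub>l X \<cdot>\<^sub>l w = U \<cdot>\<^sub>l w" for w
    by (simp add: WX flip: d.lact_mult)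
  have WQ': "W \<cdot>\<^sub>l Q \<cdot>\<^sub>l w = - (\<phi> \<cdot>\<^sub>l W \<cdot>\<^sub>l w)" for w
    using arg_cong[OF WQ, of "\<lambda>a. a \<cdot>\<^sub>l w"] by (simp add: d.lact_mult d.lact_minus_left)
  have WV': "W \<cdot>\<^sub>l V \<cdot>\<^sub>l w = U \<cdot>\<^sub>l Z \<cdot>\<^sub>l w" for w
    using arg_cong[OF WV, of "\<lambda>a. a \<cdot>\<^sub>l w"] by (simp add: d.lact_mult)
  have d\<phi>: "d \<phi> = d \<phi>\<^sub>0 + (d U \<cdot>\<^sub>r Z + W \<cdot>\<^sub>l d V - W \<cdot>\<^sub>l (d X \<cdot>\<^sub>r Z))"
    by (simp add: \<phi> d.add d.derivation_sandwich[OF XZ WX])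
  have dUP: "d U \<cdot>\<^sub>r P + U \<cdot>\<^sub>l d P = - (d \<phi>\<^sub>0 \<cdot>\<^sub>r U + \<phi>\<^sub>0 \<cdot>\<^sub>l d U)"
    using arg_cong[OF UP, of d] by (simp add: d.leibniz d.neg)
  have "d X \<cdot>\<^sub>r P + X \<cdot>\<^sub>l d P - (d Q \<cdot>\<^sub>r X + Q \<cdot>\<^sub>l d X) = d V \<cdot>\<^sub>r U + V \<cdot>\<^sub>l d U"
    using arg_cong[OF sylv, of d] by (simp add: d.leibniz d.diff)
  \<comment> \<open>Solved for \<open>d Q\<close>, since acting with \<open>Z\<close> from the right
    then yields the term that occurs in \<open>d (Q * V)\<close>.\<close>
  then have "d Q \<cdot>\<^sub>r X = d X \<cdot>\<^sub>r P + X \<cdot>\<^sub>l d P - Q \<cdot>\<^sub>l d X - d V \<cdot>\<^sub>r U - V \<cdot>\<^sub>l d U"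
    by (simp add: algebra_simps)
  then have dQV: "d Q \<cdot>\<^sub>r V
      = (d X \<cdot>\<^sub>r P + X \<cdot>\<^sub>l d P - Q \<cdot>\<^sub>l d X - d V \<cdot>\<^sub>r U - V \<cdot>\<^sub>l d U) \<cdot>\<^sub>r Z"
    using V by metis
  \<comment> \<open>After inserting \<open>dQV\<close>, the terms \<open>W (d X) P Z\<close> and
    \<open>W (d V) U Z\<close> cancel, and \<open>W * X = U\<close> completes the derivative of
    \<open>U * P\<close>.\<close>
  have "dbar (U * Z) = (d U \<cdot>\<^sub>r P + U \<cdot>\<^sub>l d P) \<cdot>\<^sub>r Z + d \<phi>\<^sub>0 \<cdot>\<^sub>r (U * Z)
      + \<phi> \<cdot>\<^sub>l W \<cdot>\<^sub>l (d X \<cdot>\<^sub>r Z) - U \<cdot>\<^sub>l Z \<cdot>\<^sub>l (d U \<cdot>\<^sub>r Z) - \<phi> \<cdot>\<^sub>l W \<cdot>\<^sub>l d V - U \<cdot>\<^sub>l Z \<cdot>\<^sub>l d \<phi>\<^sub>0"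
    unfolding dbar_dressing[OF XZ WX dbarU dbarV dbarX]
    by (simp add: d.leibniz dQV d.act_distribs d.act_assocs U WQ' WV')
  then have "dbar \<phi> = - (\<phi>\<^sub>0 \<cdot>\<^sub>l d \<phi>\<^sub>0) + (- (\<phi>\<^sub>0 \<cdot>\<^sub>l (d U \<cdot>\<^sub>r Z))
      + \<phi> \<cdot>\<^sub>l W \<cdot>\<^sub>l (d X \<cdot>\<^sub>r Z) - U \<cdot>\<^sub>l Z \<cdot>\<^sub>l (d U \<cdot>\<^sub>r Z) - \<phi> \<cdot>\<^sub>l W \<cdot>\<^sub>l d V - U \<cdot>\<^sub>l Z \<cdot>\<^sub>l d \<phi>\<^sub>0)"
    unfolding dUP by (simp add: \<phi> dbar.add seed d.act_distribs d.act_assocs)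
  \<comment> \<open>The coefficients \<phi>\<open>\<^sub>0\<close> and \<open>U * Z\<close> of
    \<open>d U\<close> and of \<open>d \<phi>\<^sub>0\<close> add up to \<phi>.\<close>
  also have "\<dots> = - (\<phi> \<cdot>\<^sub>l d \<phi>)"
    unfolding d\<phi> by (simp add: \<phi> d.act_distribs d.act_assocs)
  finally show ?thesis .
qed

end

theorem corollary3p6:
  fixes scaleB :: "'k::comm_ring_1 \<Rightarrow> 'b::ring_1 \<Rightarrow> 'b"
    and scaleW :: "'k \<Rightarrow> 'w::ab_group_add \<Rightarrow> 'w"
    and lact :: "'b matalg \<Rightarrow> 'w \<Rightarrow> 'w" (infixr "\<cdot>\<^sub>l" 70)
    and ract :: "'w \<Rightarrow> 'b matalg \<Rightarrow> 'w" (infixl "\<cdot>\<^sub>r" 70)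
    and d dbar :: "'b matalg \<Rightarrow> 'w"
    and m n :: nat
    and \<phi>\<^sub>0 \<phi> P Q U V X Xinv :: "'b matalg"
    and \<alpha> \<beta> :: 'w
  assumes "assoc_algebra scaleB"
    and "algebra_bimodule (mat_scale scaleB) scaleW lact ract"
    and "derivation (mat_scale scaleB) scaleW lact ract d"
    and "derivation (mat_scale scaleB) scaleW lact ract dbar"
    and "preserves_size lact ract d"
    and "preserves_size lact ract dbar"
    and "d (Idm m) = 0" and "d (Idm n) = 0"
    and "dbar (Idm m) = 0" and "dbar (Idm n) = 0"
    and "\<phi>\<^sub>0 \<in> Mat m m"
    and "P \<in> Mat n n" and "Q \<in> Mat n n"
    and "U \<in> Mat m n" and "V \<in> Mat n m"
    and "X \<in> Mat n n"
    and "Xinv \<in> Mat n n" and "X * Xinv = Idm n" and "Xinv * X = Idm n"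
    and "has_size lact ract n n \<alpha>" and "has_size lact ract n n \<beta>"
    and "dbar P - d P \<cdot>\<^sub>r P = - (\<alpha> \<cdot>\<^sub>r P - P \<cdot>\<^sub>l \<alpha>)"
    and "dbar Q - Q \<cdot>\<^sub>l d Q = \<beta> \<cdot>\<^sub>r Q - Q \<cdot>\<^sub>l \<beta>"
    and "dbar U = d U \<cdot>\<^sub>r P + d \<phi>\<^sub>0 \<cdot>\<^sub>r U + U \<cdot>\<^sub>l \<alpha>"
    and "dbar V = Q \<cdot>\<^sub>l d V - V \<cdot>\<^sub>l d \<phi>\<^sub>0 + \<beta> \<cdot>\<^sub>r V"
    and "X * P - Q * X = V * U"
    and "dbar X - d X \<cdot>\<^sub>r P + d Q \<cdot>\<^sub>r X + d V \<cdot>\<^sub>r U = X \<cdot>\<^sub>l \<alpha> + \<beta> \<cdot>\<^sub>r X"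
    and "\<phi> = \<phi>\<^sub>0 + U * Xinv * V"
  shows "(dbar \<phi>\<^sub>0 - d \<phi>\<^sub>0 \<cdot>\<^sub>r \<phi>\<^sub>0 = 0 \<and> Q * V = V * \<phi>\<^sub>0 \<longrightarrow> dbar \<phi> - d \<phi> \<cdot>\<^sub>r \<phi> = 0) \<and>
         (dbar \<phi>\<^sub>0 + \<phi>\<^sub>0 \<cdot>\<^sub>l d \<phi>\<^sub>0 = 0 \<and> U * P = - (\<phi>\<^sub>0 * U) \<longrightarrow> dbar \<phi> + \<phi> \<cdot>\<^sub>l d \<phi> = 0)"
proof -
  interpret d: derivation "mat_scale scaleB" scaleW lact ract d by fact
  interpret dbar: derivation "mat_scale scaleB" scaleW lact ract dbar by fact
  interpret derivation_pair "mat_scale scaleB" scaleW lact ract d dbar ..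
  let ?Z = "Xinv * V" and ?W = "U * Xinv"
  note XXi = \<open>X * Xinv = Idm n\<close> and XiX = \<open>Xinv * X = Idm n\<close>
  note sylv = \<open>X * P - Q * X = V * U\<close>
  have XZ: "X * ?Z = V"
    using Idm_mult(1)[OF \<open>V \<in> Mat n m\<close>] by (simp add: XXi flip: mult.assoc)
  have WX: "?W * X = U"
    using Idm_mult(2)[OF \<open>U \<in> Mat m n\<close>] by (simp add: XiX mult.assoc)
  have \<phi>: "\<phi> = \<phi>\<^sub>0 + U * ?Z" and \<phi>': "\<phi> = \<phi>\<^sub>0 + ?W * V"
    using \<open>\<phi> = \<phi>\<^sub>0 + U * Xinv * V\<close> by (simp_all add: mult.assoc)
  have XP: "X * P = V * U + Q * X" and QX: "Q * X = X * P - V * U"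
    using sylv by (simp_all add: algebra_simps)
  show ?thesis
  proof (intro conjI impI; elim conjE)
    assume seed: "dbar \<phi>\<^sub>0 - d \<phi>\<^sub>0 \<cdot>\<^sub>r \<phi>\<^sub>0 = 0" and QV: "Q * V = V * \<phi>\<^sub>0"
    \<comment> \<open>Inserting \<open>Xinv * X\<close> creates the product \<open>X * P\<close>,
      which the Sylvester equation rewrites.\<close>
    have "P * ?Z = Xinv * (X * P) * ?Z"
      using Idm_mult(1)[OF \<open>P \<in> Mat n n\<close>] by (simp add: XiX flip: mult.assoc)
    also have "\<dots> = Xinv * (V * (U * ?Z) + Q * (X * ?Z))"
      by (simp add: XP algebra_simps)
    also have "\<dots> = ?Z * \<phi>"
      by (simp add: XZ QV \<phi> algebra_simps)
    finally have "P * ?Z = ?Z * \<phi>" .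
    then have "dbar \<phi> = d \<phi> \<cdot>\<^sub>r \<phi>"
      by (rule dressing_right[OF XZ WX assms(24,25,27) \<phi> _ QV]) (use seed in simp)
    then show "dbar \<phi> - d \<phi> \<cdot>\<^sub>r \<phi> = 0" by simp
  next
    assume seed: "dbar \<phi>\<^sub>0 + \<phi>\<^sub>0 \<cdot>\<^sub>l d \<phi>\<^sub>0 = 0" and UP: "U * P = - (\<phi>\<^sub>0 * U)"
    \<comment> \<open>Dually, inserting \<open>X * Xinv\<close> on the right creates
      \<open>Q * X\<close>.\<close>
    have "?W * Q = ?W * (Q * X) * Xinv"
      using Idm_mult(2)[OF \<open>Q \<in> Mat n n\<close>] by (simp add: XXi mult.assoc)
    also have "\<dots> = ((?W * X) * P - ?W * V * U) * Xinv"
      by (simp add: QX algebra_simps)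
    also have "\<dots> = - (\<phi> * ?W)"
      by (simp only: WX UP \<phi>') (simp add: algebra_simps)
    finally have "?W * Q = - (\<phi> * ?W)" .
    then have "dbar \<phi> = - (\<phi> \<cdot>\<^sub>l d \<phi>)"
      by (rule dressing_left[OF XZ WX assms(24,25,26,27) \<phi> _ UP])
        (use seed in \<open>simp add: eq_neg_iff_add_eq_0\<close>)
    then show "dbar \<phi> + \<phi> \<cdot>\<^sub>l d \<phi> = 0" by simp
  qed
qed

end
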